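(* Let $\mathcal{X}$ be a p-adic Hilbert space and let $T:\mathcal{X}\to\mathcal{X}$ be a magic contraction, with associated self-adjoint bounded linear operators $M_T, M_{T^*}:\mathcal{X}\to\mathcal{X}$ (satisfying $M_T^2=I_\mathcal{X}-T^*T$, $M_{T^*}^2=I_\mathcal{X}-TT^*$, $TM_T=M_{T^*}T$). Let $N\ge 1$ be a natural number. Then the operator $$U:=\begin{pmatrix} T&0&0&\cdots&0&0&M_{T^*}\\ M_T&0&0&\cdots&0&0&-T^*\\ 0&I_\mathcal{X}&0&\cdots&0&0&0\\ 0&0&I_\mathcal{X}&\cdots&0&0&0\\ \vdots&\vdots&\vdots&&\vdots&\vdots&\vdots\\ 0&0&0&\cdots&0&0&0\\ 0&0&0&\cdots&I_\mathcal{X}&0&0\\ 0&0&0&\cdots&0&I_\mathcal{X}&0 \end{pmatrix}_{(N+1)\times(N+1)},$$ that is, $U(x_1,\dots,x_{N+1})=(Tx_1+M_{T^*}x_{N+1},\ M_Tx_1-T^*x_{N+1},\ x_2,\ x_3,\dots,x_N)$, is unitary on $\oplus_{k=1}^{N+1}\mathcal{X}$ and $$T^k=P_\mathcal{X}U^k|_\mathcal{X}\quad\text{and}\quad (T^* )^k=P_\mathcal{X}(U^* )^k|_\mathcal{X}\qquad\text{for all }k=1,\dots,N,$$ where $P_\mathcal{X}:\oplus_{k=1}^{N+1}\mathcal{X}\ni(x_k)_{k=1}^{N+1}\mapsto x_1\in\mathcal{X}$ and $|_\mathcal{X}$ denotes restriction to $\mathcal{X}$ embedded as the first summand, $x\m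apsto(x,0,\dots,0)$.
   Context: p-adic Hilbert space: Let $\mathbb{K}$ be a complete non-Archimedean valued field with valuation $|\cdot|$, and let $\mathcal{X}$ be a non-Archimedean Banach space over $\mathbb{K}$ with norm $\|\cdot\|$. $\mathcal{X}$ is a p-adic Hilbert space if there is a map (inner product) $\langle\cdot,\cdot\rangle:\mathcal{X}\times\mathcal{X}\to\mathbb{K}$ such that (i) if $\langle x,y\rangle=0$ for all $y\in\mathcal{X}$ then $x=0$; (ii) $\langle x,y\rangle=\langle y,x\rangle$ for all $x,y$; (iii) $\langle\alpha x+y,z\rangle=\alpha\langle x,z\rangle+\langle y,z\rangle$ for all $\alpha\in\mathbb{K}$ and $x,y,z\in\mathcal{X}$; (iv) $|\langle x,y\rangle|\le\|x\|\|y\|$ for all $x,y$. Operators: a bounded linear operator $T:\mathcal{X}\to\mathcal{X}$ is adjointable if there is a bounded linear operator $T^*:\mathcal{X}\to\mathcal{X}$ with $\langle Tx,y\rangle=\langle x,T^*y\rangle$ for all $x,y\in\mathcal{X}$ (it is then unique). An adjointable $T$ is self-adjoint if $T^*=T$; an adjointable $U$ is unitary if $UU^*=U^*U=I_\mathcal{X}$, the identity operator on $\mathcal{X}$. Magic contraction: a bounded linear adjointable operator $T:\mathcal{X}\to\mathcal{X}$ is a magic contraction if there are self-adjoint bounded linear operators $M_T, M_{T^*}:\mathcal{X}\to\mathcal{X}$ (not necessarily unique) such that $M_T^2=I_\mathcal{X}-T^*T$, $M_{T^*}^2=I_\mathcal{X}-TT^*$ and $TM_T=M_{T^*}T$. The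 direct sum $\oplus_{k=1}^{N+1}\mathcal{X}$ is a p-adic Hilbert space with norm $\|(x_k)_k\|=\max_k\|x_k\|$ and inner product $\langle(x_k)_k,(y_k)_k\rangle=\sum_{k=1}^{N+1}\langle x_k,y_k\rangle$; operator matrices act on column vectors. For $N=1$ the matrix is $\begin{pmatrix} T & M_{T^*} \\ M_T & -T^* \end{pmatrix}$. *)

theory Defs
  imports "HOL-Analysis.Abstract_Metric_Spaces" "HOL-Library.Function_Algebras"
begin

text \<open>
  Spaces are carried by a linear subspace of an ambient vector space type, because the direct sum
  of \<open>n\<close> copies of a space has to be formed for a variable number \<open>n\<close>. Operators are total
  functions on the ambient type of which only the values on the carrier are relevant.
\<close>

locale complete_nonarch_field =
  fixes v :: "'k::field \<Rightarrow> real"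
  assumes val_nonneg: "0 \<le> v a"
    and val_eq_0_iff: "v a = 0 \<longleftrightarrow> a = 0"
    and val_mult: "v (a * b) = v a * v b"
    and val_add: "v (a + b) \<le> max (v a) (v b)"
    and val_complete: "Metric_space.mcomplete UNIV (\<lambda>a b. v (a - b))"

record ('k, 'a) inner_space =
  hcarrier :: "'a set"
  hscale :: "'k \<Rightarrow> 'a \<Rightarrow> 'a"
  hnorm :: "'a \<Rightarrow> real"
  hinner :: "'a \<Rightarrow> 'a \<Rightarrow> 'k"

locale nonarch_banach_space =
  complete_nonarch_field v + vector_space "hscale H"
  for v :: "'k::field \<Rightarrow> real" and H :: "('k, 'a::ab_group_add) inner_space" +
  assumes subspace_carrier: "subspace (hcarrier H)"
    and norm_nonneg: "x \<in> hcarrier H \<Longrightarrow> 0 \<le> hnorm H x"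
    and norm_eq_0_iff: "x \<in> hcarrier H \<Longrightarrow> hnorm H x = 0 \<longleftrightarrow> x = 0"
    and norm_scale: "x \<in> hcarrier H \<Longrightarrow> hnorm H (hscale H a x) = v a * hnorm H x"
    and norm_add: "x \<in> hcarrier H \<Longrightarrow> y \<in> hcarrier H \<Longrightarrow>
          hnorm H (x + y) \<le> max (hnorm H x) (hnorm H y)"
    \<comment> \<open>\<^locale>\<open>Metric_space\<close> requires the distance to be nonnegative and symmetric on the whole
      type, and \<open>hnorm\<close> is unconstrained off the carrier, hence the default value 0\<close>
    and norm_complete: "Metric_space.mcomplete (hcarrier H)
          (\<lambda>x y. if x \<in> hcarrier H \<and> y \<in> hcarrier H then hnorm H (x - y) else 0)"

locale padic_hilbert_space = nonarch_banach_space v H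
  for v :: "'k::field \<Rightarrow> real" and H :: "('k, 'a::ab_group_add) inner_space" +
  assumes inner_nondegenerate:
      "x \<in> hcarrier H \<Longrightarrow> (\<And>y. y \<in> hcarrier H \<Longrightarrow> hinner H x y = 0) \<Longrightarrow> x = 0"
    and inner_commute: "x \<in> hcarrier H \<Longrightarrow> y \<in> hcarrier H \<Longrightarrow> hinner H x y = hinner H y x"
    and inner_linear: "x \<in> hcarrier H \<Longrightarrow> y \<in> hcarrier H \<Longrightarrow> z \<in> hcarrier H \<Longrightarrow>
          hinner H (hscale H a x + y) z = a * hinner H x z + hinner H y z"
    and inner_bound: "x \<in> hcarrier H \<Longrightarrow> y \<in> hcarrier H \<Longrightarrow>
          v (hinner H x y) \<le> hnorm H x * hnorm H y"

definition bounded_operator ::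
    "('k, 'a::ab_group_add) inner_space \<Rightarrow> ('a \<Rightarrow> 'a) \<Rightarrow> bool" where
  "bounded_operator H T \<longleftrightarrow>
     T \<in> hcarrier H \<rightarrow> hcarrier H \<and>
     (\<forall>x\<in>hcarrier H. \<forall>y\<in>hcarrier H. T (x + y) = T x + T y) \<and>
     (\<forall>a. \<forall>x\<in>hcarrier H. T (hscale H a x) = hscale H a (T x)) \<and>
     (\<exists>C. \<forall>x\<in>hcarrier H. hnorm H (T x) \<le> C * hnorm H x)"

definition is_adjoint ::
    "('k, 'a::ab_group_add) inner_space \<Rightarrow> ('a \<Rightarrow> 'a) \<Rightarrow> ('a \<Rightarrow> 'a) \<Rightarrow> bool" where
  "is_adjoint H T S \<longleftrightarrow> bounded_operator H T \<and> bounded_operator H S \<and>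
     (\<forall>x\<in>hcarrier H. \<forall>y\<in>hcarrier H. hinner H (T x) y = hinner H x (S y))"

definition adjointable :: "('k, 'a::ab_group_add) inner_space \<Rightarrow> ('a \<Rightarrow> 'a) \<Rightarrow> bool" where
  "adjointable H T \<longleftrightarrow> (\<exists>S. is_adjoint H T S)"

text \<open>The adjoint is unique on the carrier only, hence \<open>SOME\<close> rather than \<open>THE\<close>.\<close>

definition adj :: "('k, 'a::ab_group_add) inner_space \<Rightarrow> ('a \<Rightarrow> 'a) \<Rightarrow> 'a \<Rightarrow> 'a" where
  "adj H T = (SOME S. is_adjoint H T S)"

definition self_adjoint :: "('k, 'a::ab_group_add) inner_space \<Rightarrow> ('a \<Rightarrow> 'a) \<Rightarrow> bool" where
  "self_adjoint H T \<longleftrightarrow> adjointable H T \<and> (\<forall>x\<in>hcarrier H. adj H T x = T x)"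

definition unitary :: "('k, 'a::ab_group_add) inner_space \<Rightarrow> ('a \<Rightarrow> 'a) \<Rightarrow> bool" where
  "unitary H U \<longleftrightarrow> adjointable H U \<and>
     (\<forall>x\<in>hcarrier H. U (adj H U x) = x \<and> adj H U (U x) = x)"

text \<open>\<open>M\<close> and \<open>M'\<close> are the operators written $M_T$ and $M_{T^*}$.\<close>

definition magic_operators ::
    "('k, 'a::ab_group_add) inner_space \<Rightarrow> ('a \<Rightarrow> 'a) \<Rightarrow> ('a \<Rightarrow> 'a) \<Rightarrow> ('a \<Rightarrow> 'a) \<Rightarrow> bool" where
  "magic_operators H T M M' \<longleftrightarrow> self_adjoint H M \<and> self_adjoint H M' \<and>
     (\<forall>x\<in>hcarrier H. M (M x) = x - adj H T (T x) \<and>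
                      M' (M' x) = x - T (adj H T x) \<and>
                      T (M x) = M' (T x))"

definition magic_contraction :: "('k, 'a::ab_group_add) inner_space \<Rightarrow> ('a \<Rightarrow> 'a) \<Rightarrow> bool" where
  "magic_contraction H T \<longleftrightarrow> adjointable H T \<and> (\<exists>M M'. magic_operators H T M M')"

text \<open>
  A family $(x_1,\dots,x_n)$ is encoded as a function on \<^typ>\<open>nat\<close> vanishing outside \<open>{1..n}\<close>.
\<close>

definition direct_sum ::
    "nat \<Rightarrow> ('k::field, 'a::ab_group_add) inner_space \<Rightarrow> ('k, nat \<Rightarrow> 'a) inner_space" where
  "direct_sum n H =
     \<lparr> hcarrier = {x. (\<forall>k\<in>{1..n}. x k \<in> hcarrier H) \<and> (\<forall>k. k \<notin> {1..n} \<longrightarrow> x k = 0)},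
       hscale = (\<lambda>a x k. hscale H a (x k)),
       hnorm = (\<lambda>x. Max ((\<lambda>k. hnorm H (x k)) ` {1..n})),
       hinner = (\<lambda>x y. \<Sum>k=1..n. hinner H (x k) (y k)) \<rparr>"

text \<open>The action of an \<open>n\<close> by \<open>n\<close> operator matrix on column vectors, with indices from 1.\<close>

definition matrix_operator ::
    "nat \<Rightarrow> (nat \<Rightarrow> nat \<Rightarrow> 'a \<Rightarrow> 'a) \<Rightarrow> (nat \<Rightarrow> 'a::ab_group_add) \<Rightarrow> nat \<Rightarrow> 'a" where
  "matrix_operator n A x = (\<lambda>i. if i \<in> {1..n} then \<Sum>j=1..n. A i j (x j) else 0)"

definition dilation_matrix ::
    "('k, 'a::ab_group_add) inner_space \<Rightarrow> nat \<Rightarrow> ('a \<Rightarrow> 'a) \<Rightarrow> ('a \<Rightarrow> 'a) \<Rightarrow> ('a \<Rightarrow> 'a)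
       \<Rightarrow> nat \<Rightarrow> nat \<Rightarrow> 'a \<Rightarrow> 'a" where
  "dilation_matrix H N T M M' i j =
     (if i = 1 \<and> j = 1 then T
      else if i = 1 \<and> j = N + 1 then M'
      else if i = 2 \<and> j = 1 then M
      else if i = 2 \<and> j = N + 1 then (\<lambda>x. - adj H T x)
      else if 3 \<le> i \<and> j + 1 = i then (\<lambda>x. x)
      else (\<lambda>x. 0))"

definition dilation ::
    "('k, 'a::ab_group_add) inner_space \<Rightarrow> nat \<Rightarrow> ('a \<Rightarrow> 'a) \<Rightarrow> ('a \<Rightarrow> 'a) \<Rightarrow> ('a \<Rightarrow> 'a)
       \<Rightarrow> (nat \<Rightarrow> 'a) \<Rightarrow> nat \<Rightarrow> 'a" where
  "dilation H N T M M' = matrix_operator (N + 1) (dilation_matrix H N T M M')"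

definition first_embedding :: "'a::ab_group_add \<Rightarrow> nat \<Rightarrow> 'a" where
  "first_embedding x = (\<lambda>k. if k = 1 then x else 0)"

definition first_projection :: "(nat \<Rightarrow> 'a) \<Rightarrow> 'a" where
  "first_projection x = x 1"

lemma dilation_apply:
  assumes "1 \<le> N"
  shows "dilation H N T M M' x =
    (\<lambda>i. if i = 1 then T (x 1) + M' (x (N + 1))
         else if i = 2 then M (x 1) - adj H T (x (N + 1))
         else if 3 \<le> i \<and> i \<le> N + 1 then x (i - 1)
         else 0)"
proof
  fix i
  have two: "(\<Sum>j=1..N+1. f j) = f 1 + f (N + 1)"
    if "\<And>j. 1 < j \<Longrightarrow> j \<le> N \<Longrightarrow> f j = 0" for f :: "nat \<Rightarrow> 'a"
  proof -
    have "(\<Sum>j=1..N+1. f j) = (\<Sum>j\<in>{1, N+1}. f j)"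
      using assms that by (intro sum.mono_neutral_right) auto
    then show ?thesis using assms by simp
  qed
  have one: "(\<Sum>j=1..N+1. if j + 1 = i then x j else 0) = x (i - 1)" if "3 \<le> i" "i \<le> N + 1"
  proof -
    have "(\<Sum>j=1..N+1. if j + 1 = i then x j else 0) = (\<Sum>j\<in>{i-1}. x j)"
      using that by (intro sum.mono_neutral_cong_right) auto
    then show ?thesis by simp
  qed
  consider "i = 1" | "i = 2" | "3 \<le> i" "i \<le> N + 1" | "i = 0 \<or> N + 1 < i" by linarith
  then show "dilation H N T M M' x i =
    (if i = 1 then T (x 1) + M' (x (N + 1))
         else if i = 2 then M (x 1) - adj H T (x (N + 1))
         else if 3 \<le> i \<and> i \<le> N + 1 then x (i - 1)
         else 0)"
  proof cases
    case 1
    then show ?thesis using assms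
      unfolding dilation_def matrix_operator_def by (subst two) (auto simp: dilation_matrix_def)
  next
    case 2
    then show ?thesis using assms
      unfolding dilation_def matrix_operator_def by (subst two) (auto simp: dilation_matrix_def)
  next
    case 3
    have "dilation H N T M M' x i = (\<Sum>j=1..N+1. if j + 1 = i then x j else 0)"
      using 3 by (auto simp: dilation_def matrix_operator_def dilation_matrix_def
                       intro!: sum.cong)
    then show ?thesis using 3 one by auto
  next
    case 4
    then show ?thesis using assms by (auto simp: dilation_def matrix_operator_def)
  qed
qed

lemma (in nonarch_banach_space) carrier_diff:
  "x \<in> hcarrier H \<Longrightarrow> y \<in> hcarrier H \<Longrightarrow> x - y \<in> hcarrier H"
  using subspace_carrier by (rule subspace_diff)

lemma (in nonarch_banach_space) norm_minus_commute:
  assumes "x \<in> hcarrier H" "y \<in> hcarrier H"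
  shows "hnorm H (x - y) = hnorm H (y - x)"
proof -
  have "v (-1) * v (-1) = v 1" "v 1 * v 1 = v 1"
    by (simp_all flip: val_mult)
  moreover have "v 1 \<noteq> 0" by (simp add: val_eq_0_iff)
  ultimately have "(v (-1))\<^sup>2 = 1" by (simp add: power2_eq_square)
  then have "v (-1) = 1" using val_nonneg[of "-1"] by (simp add: power2_eq_1_iff)
  moreover have "hscale H (-1) (y - x) = x - y"
    by (simp add: scale_minus_left)
  ultimately show ?thesis
    using norm_scale[OF carrier_diff[OF assms(2,1)], of "-1"] by simp
qed

lemma (in nonarch_banach_space) metric_space_carrier:
  "Metric_space (hcarrier H)
     (\<lambda>x y. if x \<in> hcarrier H \<and> y \<in> hcarrier H then hnorm H (x - y) else 0)"
proof
  fix x y z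
  assume xyz: "x \<in> hcarrier H" "y \<in> hcarrier H" "z \<in> hcarrier H"
  have "hnorm H (x - z) \<le> max (hnorm H (x - y)) (hnorm H (y - z))"
    using norm_add[OF carrier_diff[of x y] carrier_diff[of y z]] xyz by simp
  then show "(if x \<in> hcarrier H \<and> z \<in> hcarrier H then hnorm H (x - z) else 0)
    \<le> (if x \<in> hcarrier H \<and> y \<in> hcarrier H then hnorm H (x - y) else 0) +
      (if y \<in> hcarrier H \<and> z \<in> hcarrier H then hnorm H (y - z) else 0)"
    using xyz norm_nonneg[OF carrier_diff[of x y]] norm_nonneg[OF carrier_diff[of y z]] by simp
next
  fix x y
  assume "x \<in> hcarrier H" "y \<in> hcarrier H"
  then show "(if x \<in> hcarrier H \<and> y \<in> hcarrier H then hnorm H (x - y) else 0) = 0 \<longleftrightarrow> x = y"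
    using norm_eq_0_iff[OF carrier_diff[of x y]] by simp
qed (auto intro: norm_nonneg carrier_diff norm_minus_commute)

lemma (in padic_hilbert_space) padic_hilbert_space_direct_sum:
  assumes n: "1 \<le> n"
  shows "padic_hilbert_space v (direct_sum n H)"
proof -
  let ?D = "direct_sum n H"
  have D_iff: "x \<in> hcarrier ?D \<longleftrightarrow>
      (\<forall>k\<in>{1..n}. x k \<in> hcarrier H) \<and> (\<forall>k. k \<notin> {1..n} \<longrightarrow> x k = 0)" for x
    by (simp add: direct_sum_def)
  have sc: "hscale ?D = (\<lambda>a x k. hscale H a (x k))"
    by (simp add: direct_sum_def)
  have nm: "hnorm ?D x = Max ((\<lambda>k. hnorm H (x k)) ` {1..n})" for x
    by (simp add: direct_sum_def)
  have ip: "hinner ?D x y = (\<Sum>k=1..n. hinner H (x k) (y k))" for x y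
    by (simp add: direct_sum_def)
  have ne: "{1..n} \<noteq> {}" using n by simp
  have le_nm: "hnorm H (x k) \<le> hnorm ?D x" if "k \<in> {1..n}" for x k
    unfolding nm using that by (intro Max_ge) auto
  have nm_le: "hnorm ?D x \<le> c" if "\<And>k. k \<in> {1..n} \<Longrightarrow> hnorm H (x k) \<le> c" for x c
    unfolding nm using that ne by (subst Max_le_iff) auto
  have nm_lt: "hnorm ?D x < c" if "\<And>k. k \<in> {1..n} \<Longrightarrow> hnorm H (x k) < c" for x c
    unfolding nm using that ne by (subst Max_less_iff) auto
  have nm_at: "\<exists>k\<in>{1..n}. hnorm ?D x = hnorm H (x k)" for x
    using Max_in[of "(\<lambda>k. hnorm H (x k)) ` {1..n}"] ne unfolding nm by fastforce
  have vsD: "vector_space (hscale ?D)"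
    unfolding sc by unfold_locales (auto simp: fun_eq_iff scale_right_distrib scale_left_distrib)
  interpret D: vector_space "hscale ?D" by (rule vsD)
  have comp: "x k \<in> hcarrier H" if "x \<in> hcarrier ?D" for x k
    using that subspace_0[OF subspace_carrier] by (cases "k \<in> {1..n}") (auto simp: D_iff)
  have sub: "D.subspace (hcarrier ?D)"
    unfolding D.subspace_def
    by (auto simp: D_iff sc intro: subspace_0 subspace_add subspace_scale subspace_carrier)
  have nonneg: "0 \<le> hnorm ?D x" if "x \<in> hcarrier ?D" for x
    using nm_at[of x] norm_nonneg comp[OF that] by metis
  have eq0: "hnorm ?D x = 0 \<longleftrightarrow> x = 0" if x: "x \<in> hcarrier ?D" for x
  proof
    assume 0: "hnorm ?D x = 0"
    have "x k = 0" for k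
    proof (cases "k \<in> {1..n}")
      case True
      then have "hnorm H (x k) = 0"
        using le_nm[OF True, of x] norm_nonneg[OF comp[OF x, of k]] 0 by simp
      then show ?thesis using norm_eq_0_iff comp[OF x] by blast
    next
      case False
      then show ?thesis using x by (simp add: D_iff)
    qed
    then show "x = 0" by (simp add: fun_eq_iff)
  next
    assume "x = 0"
    moreover have "hnorm H 0 = 0"
      using norm_eq_0_iff subspace_0[OF subspace_carrier] by blast
    ultimately show "hnorm ?D x = 0" using nm_at[of x] by auto
  qed
  have hom: "hnorm ?D (hscale ?D a x) = v a * hnorm ?D x" if x: "x \<in> hcarrier ?D" for a x
  proof (rule antisym)
    show "hnorm ?D (hscale ?D a x) \<le> v a * hnorm ?D x"
      by (rule nm_le) (auto simp: sc norm_scale comp[OF x] intro!: mult_left_mono le_nm val_nonneg)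
    obtain k where k: "k \<in> {1..n}" "hnorm ?D x = hnorm H (x k)" using nm_at by blast
    then show "v a * hnorm ?D x \<le> hnorm ?D (hscale ?D a x)"
      using le_nm[OF k(1), of "hscale ?D a x"] norm_scale[OF comp[OF x], of a k]
      by (simp add: sc)
  qed
  have ultra: "hnorm ?D (x + y) \<le> max (hnorm ?D x) (hnorm ?D y)"
    if "x \<in> hcarrier ?D" "y \<in> hcarrier ?D" for x y
  proof (rule nm_le)
    fix k assume "k \<in> {1..n}"
    then show "hnorm H ((x + y) k) \<le> max (hnorm ?D x) (hnorm ?D y)"
      using norm_add[OF comp[OF that(1)] comp[OF that(2)], of k k] le_nm[of k x] le_nm[of k y]
      by auto
  qed
  let ?d = "\<lambda>x y. if x \<in> hcarrier H \<and> y \<in> hcarrier H then hnorm H (x - y) else 0"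
  let ?dD = "\<lambda>x y. if x \<in> hcarrier ?D \<and> y \<in> hcarrier ?D then hnorm ?D (x - y) else 0"
  interpret m: Metric_space "hcarrier H" ?d by (rule metric_space_carrier)
  have mD: "Metric_space (hcarrier ?D) ?dD"
  proof
    fix x y z
    assume xyz: "x \<in> hcarrier ?D" "y \<in> hcarrier ?D" "z \<in> hcarrier ?D"
    have "hnorm ?D (x - z) \<le> max (hnorm ?D (x - y)) (hnorm ?D (y - z))"
      using ultra[of "x - y" "y - z"] D.subspace_diff[OF sub] xyz by simp
    then show "?dD x z \<le> ?dD x y + ?dD y z"
      using xyz nonneg[of "x - y"] nonneg[of "y - z"] D.subspace_diff[OF sub] by simp
  next
    fix x y
    assume "x \<in> hcarrier ?D" "y \<in> hcarrier ?D"
    then show "?dD x y = 0 \<longleftrightarrow> x = y"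
      using eq0[of "x - y"] D.subspace_diff[OF sub] by simp
  next
    fix x y
    show "0 \<le> ?dD x y" using nonneg D.subspace_diff[OF sub] by auto
    have "hnorm ?D (x - y) = hnorm ?D (y - x)" if "x \<in> hcarrier ?D" "y \<in> hcarrier ?D"
      unfolding nm using norm_minus_commute[OF comp[OF that(1)] comp[OF that(2)]] by simp
    then show "?dD x y = ?dD y x" by simp
  qed
  interpret mD: Metric_space "hcarrier ?D" ?dD by (rule mD)
  have complete: "mD.mcomplete"
    unfolding mD.mcomplete_def
  proof (intro allI impI)
    fix s assume s: "mD.MCauchy s"
    then have sD: "s i \<in> hcarrier ?D" for i by (auto simp: mD.MCauchy_def)
    have "\<exists>l. limitin m.mtopology (\<lambda>i. s i k) l sequentially" if k: "k \<in> {1..n}" for k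
    proof -
      have "m.MCauchy (\<lambda>i. s i k)"
        unfolding m.MCauchy_def
      proof (intro conjI allI impI)
        show "range (\<lambda>i. s i k) \<subseteq> hcarrier H" using comp[OF sD] by auto
        fix e :: real assume "0 < e"
        then obtain B where B: "\<And>i j. B \<le> i \<Longrightarrow> B \<le> j \<Longrightarrow> ?dD (s i) (s j) < e"
          using s unfolding mD.MCauchy_def by meson
        have "?d (s i k) (s j k) < e" if "B \<le> i" "B \<le> j" for i j
          using B[OF that] le_nm[OF k, of "s i - s j"] sD comp[OF sD] by auto
        then show "\<exists>B. \<forall>i j. B \<le> i \<longrightarrow> B \<le> j \<longrightarrow> ?d (s i k) (s j k) < e" by blast
      qed
      then show ?thesis using norm_complete unfolding m.mcomplete_def by blast
    qed
    then have "\<forall>k\<in>{1..n}. \<exists>l. limitin m.mtopology (\<lambda>i. s i k) l sequentially" ..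
    from bchoice[OF this] obtain l
      where l: "\<And>k. k \<in> {1..n} \<Longrightarrow> limitin m.mtopology (\<lambda>i. s i k) (l k) sequentially"
      by blast
    define L where "L = (\<lambda>k. if k \<in> {1..n} then l k else 0)"
    have LH: "L k \<in> hcarrier H" if "k \<in> {1..n}" for k
      using l[OF that] that by (simp add: L_def m.limitin_metric)
    have LD: "L \<in> hcarrier ?D" using LH by (auto simp: D_iff L_def)
    have "limitin mD.mtopology s L sequentially"
      unfolding mD.limitin_metric
    proof (intro conjI allI impI)
      show "L \<in> hcarrier ?D" by (rule LD)
      fix e :: real assume "0 < e"
      then have "\<forall>k\<in>{1..n}. \<forall>\<^sub>F i in sequentially. ?d (s i k) (l k) < e"
        using l unfolding m.limitin_metric by (blast intro: eventually_mono)
      then have "\<forall>\<^sub>F i in sequentially. \<forall>k\<in>{1..n}. ?d (s i k) (l k) < e"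
        by (simp add: eventually_ball_finite)
      then show "\<forall>\<^sub>F i in sequentially. s i \<in> hcarrier ?D \<and> ?dD (s i) L < e"
      proof (rule eventually_mono)
        fix i assume i: "\<forall>k\<in>{1..n}. ?d (s i k) (l k) < e"
        have "hnorm ?D (s i - L) < e"
        proof (rule nm_lt)
          fix k assume k: "k \<in> {1..n}"
          then show "hnorm H ((s i - L) k) < e"
            using i[rule_format, OF k] LH[OF k] comp[OF sD, of i k] by (simp add: L_def)
        qed
        then show "s i \<in> hcarrier ?D \<and> ?dD (s i) L < e" using sD LD by simp
      qed
    qed
    then show "\<exists>L. limitin mD.mtopology s L sequentially" by blast
  qed
  have nondeg: "x = 0" if x: "x \<in> hcarrier ?D"
      and orth: "\<And>y. y \<in> hcarrier ?D \<Longrightarrow> hinner ?D x y = 0" for x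
  proof -
    have z: "hinner H w 0 = 0" if "w \<in> hcarrier H" for w
    proof -
      have 0: "0 \<in> hcarrier H" using subspace_carrier by (rule subspace_0)
      have "hinner H 0 w = hinner H 0 w + hinner H 0 w"
        using inner_linear[OF 0 0 that, of 1] by (simp only: scale_one add_0_left mult_1_left)
      then show ?thesis using inner_commute[OF that 0] by (simp only: add_cancel_right_right)
    qed
    have "x k = 0" for k
    proof (cases "k \<in> {1..n}")
      case True
      show ?thesis
      proof (rule inner_nondegenerate)
        show "x k \<in> hcarrier H" by (rule comp[OF x])
        fix y assume y: "y \<in> hcarrier H"
        let ?y = "\<lambda>j. if j = k then y else 0"
        have "?y \<in> hcarrier ?D"
          using True y subspace_0[OF subspace_carrier] by (auto simp: D_iff)
        then have "0 = (\<Sum>j=1..n. hinner H (x j) (?y j))" using orth ip by metis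
        also have "\<dots> = (\<Sum>j\<in>{k}. hinner H (x j) (?y j))"
          using True by (intro sum.mono_neutral_right) (auto simp: z comp[OF x])
        finally show "hinner H (x k) y = 0" by simp
      qed
    next
      case False
      then show ?thesis using x by (simp add: D_iff)
    qed
    then show ?thesis by (simp add: fun_eq_iff)
  qed
  have bound: "v (hinner ?D x y) \<le> hnorm ?D x * hnorm ?D y"
    if x: "x \<in> hcarrier ?D" and y: "y \<in> hcarrier ?D" for x y
  proof -
    have c0: "0 \<le> hnorm ?D x * hnorm ?D y" using nonneg x y by simp
    have fin: "v (\<Sum>k\<in>A. f k) \<le> c"
      if "finite A" "\<And>k. k \<in> A \<Longrightarrow> v (f k) \<le> c" "0 \<le> c" for A :: "nat set" and f c
      using that
    proof (induction A rule: finite_induct)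
      case empty
      then show ?case using val_eq_0_iff[of 0] by simp
    next
      case (insert a A)
      then show ?case using val_add[of "f a" "sum f A"] by fastforce
    qed
    show ?thesis
      unfolding ip
    proof (rule fin[OF _ _ c0])
      fix k assume k: "k \<in> {1..n}"
      have "v (hinner H (x k) (y k)) \<le> hnorm H (x k) * hnorm H (y k)"
        by (rule inner_bound[OF comp[OF x] comp[OF y]])
      also have "\<dots> \<le> hnorm ?D x * hnorm ?D y"
        by (intro mult_mono le_nm k nonneg x norm_nonneg comp[OF y])
      finally show "v (hinner H (x k) (y k)) \<le> hnorm ?D x * hnorm ?D y" .
    qed simp
  qed
  show ?thesis
  proof (intro padic_hilbert_space.intro nonarch_banach_space.intro
      nonarch_banach_space_axioms.intro padic_hilbert_space_axioms.intro)
    show "complete_nonarch_field v" by unfold_locales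
  next
    fix x y assume "x \<in> hcarrier ?D" "y \<in> hcarrier ?D"
    then show "hinner ?D x y = hinner ?D y x"
      unfolding ip by (intro sum.cong refl inner_commute comp)
  next
    fix x y z a assume "x \<in> hcarrier ?D" "y \<in> hcarrier ?D" "z \<in> hcarrier ?D"
    then show "hinner ?D (hscale ?D a x + y) z = a * hinner ?D x z + hinner ?D y z"
      by (simp add: ip sc inner_linear comp sum.distrib sum_distrib_left)
  qed (use vsD sub nonneg eq0 hom ultra complete nondeg bound in blast)+
qed

end

theory Submission
  imports Defs
begin

text \<open>
  Entrywise adjoints give the adjoint of an operator matrix, so \<open>U\<close> has the adjoint
  $U^*(y_1,\dots,y_{N+1}) = (T^*y_1 + M_T y_2,\ y_3,\dots,y_{N+1},\ M_{T^*}y_1 - T y_2)$, and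
  unitarity reduces to the defining relations of \<open>M_T\<close>, \<open>M_{T^*}\<close> together with
  $M_T T^* = T^* M_{T^*}$, the adjoint of $T M_T = M_{T^*} T$. For the powers, an entry created
  in the second coordinate by \<open>U\<close> has to travel through the shift before it reaches coordinate
  $N+1$, which takes too long to influence the first coordinate of \<open>U^k\<close> for $k \le N$; dually
  for \<open>U^*\<close>, which shifts in the opposite direction.
\<close>

section \<open>Bounded operators and adjoints, as relations on the carrier\<close>

lemma bounded_operatorI:
  assumes "\<And>x. x \<in> hcarrier H \<Longrightarrow> T x \<in> hcarrier H"
    and "\<And>x y. x \<in> hcarrier H \<Longrightarrow> y \<in> hcarrier H \<Longrightarrow> T (x + y) = T x + T y"
    and "\<And>a x. x \<in> hcarrier H \<Longrightarrow> T (hscale H a x) = hscale H a (T x)"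
    and "\<And>x. x \<in> hcarrier H \<Longrightarrow> hnorm H (T x) \<le> C * hnorm H x"
  shows "bounded_operator H T"
  using assms unfolding bounded_operator_def by blast

lemma
  assumes "bounded_operator H T" "x \<in> hcarrier H"
  shows bounded_operator_closed: "T x \<in> hcarrier H"
    and bounded_operator_add: "y \<in> hcarrier H \<Longrightarrow> T (x + y) = T x + T y"
    and bounded_operator_scale: "T (hscale H a x) = hscale H a (T x)"
  using assms by (auto simp: bounded_operator_def)

lemma adj_is_adjoint: "adjointable H T \<Longrightarrow> is_adjoint H T (adj H T)"
  unfolding adjointable_def adj_def by (erule someI_ex)

text \<open>The relation \<open>is_adjoint\<close> only tests values on the carrier, where
  \<open>T\<close> agrees with the chosen adjoint \<open>adj H T\<close>; boundedness of
  \<open>T\<close> is already part of adjointability.\<close>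

lemma self_adjoint_is_adjoint:
  assumes "self_adjoint H T"
  shows "is_adjoint H T T"
  using assms adj_is_adjoint[of H T] unfolding self_adjoint_def is_adjoint_def by auto

section \<open>Boundedness of operator matrices\<close>

context nonarch_banach_space
begin

lemma zero_in_carrier: "0 \<in> hcarrier H"
  using subspace_carrier by (rule subspace_0)

lemma bounded_operator_0: "bounded_operator H T \<Longrightarrow> T 0 = 0"
  using bounded_operator_add[of H T 0 0] zero_in_carrier by simp

lemma bounded_operator_diff:
  assumes "bounded_operator H T" "x \<in> hcarrier H" "y \<in> hcarrier H"
  shows "T (x - y) = T x - T y"
  using bounded_operator_add[OF assms(1) carrier_diff[OF assms(2,3)] assms(3)]
  by (simp add: eq_diff_eq)

lemma norm_zero: "hnorm H 0 = 0"
  using norm_eq_0_iff zero_in_carrier by blast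

lemma norm_minus: "x \<in> hcarrier H \<Longrightarrow> hnorm H (- x) = hnorm H x"
  using norm_minus_commute[of x 0] zero_in_carrier by simp

lemma bounded_operator_zero: "bounded_operator H (\<lambda>x. 0)"
  by (rule bounded_operatorI[of _ _ 0]) (auto simp: zero_in_carrier norm_zero)

lemma bounded_operator_id: "bounded_operator H (\<lambda>x. x)"
  by (rule bounded_operatorI[of _ _ 1]) auto

lemma bounded_operator_minus:
  assumes "bounded_operator H T"
  shows "bounded_operator H (\<lambda>x. - T x)"
proof -
  obtain C where "\<forall>x\<in>hcarrier H. hnorm H (T x) \<le> C * hnorm H x"
    using assms unfolding bounded_operator_def by blast
  then show ?thesis
    using bounded_operator_closed[OF assms] bounded_operator_add[OF assms]
      bounded_operator_scale[OF assms]
    by (intro bounded_operatorI[of _ _ C])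
      (auto simp: norm_minus scale_minus_right intro: subspace_neg[OF subspace_carrier])
qed

text \<open>The maximum of two nonnegative numbers is at most their sum. The ultrametric bound would
  be sharper, but boundedness only asks for some constant.\<close>

lemma norm_sum_le:
  assumes "finite A" "\<And>k. k \<in> A \<Longrightarrow> f k \<in> hcarrier H"
  shows "hnorm H (sum f A) \<le> (\<Sum>k\<in>A. hnorm H (f k))"
  using assms
proof (induction A rule: finite_induct)
  case empty
  then show ?case by (simp add: norm_zero)
next
  case (insert a A)
  have "sum f A \<in> hcarrier H"
    using insert.prems by (intro subspace_sum[OF subspace_carrier]) auto
  moreover have "0 \<le> (\<Sum>k\<in>A. hnorm H (f k))"
    using insert.prems by (intro sum_nonneg norm_nonneg) auto
  ultimately show ?case
    using insert norm_add[of "f a" "sum f A"] norm_nonneg[of "f a"] by fastforce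
qed

text \<open>Each coordinate of the image is controlled by the sum of the bounds in its row, so the
  sum of the bounds of all entries works for every coordinate at once.\<close>

lemma bounded_operator_matrix:
  assumes A: "\<And>i j. i \<in> {1..n} \<Longrightarrow> j \<in> {1..n} \<Longrightarrow> bounded_operator H (A i j)" and n: "1 \<le> n"
  shows "bounded_operator (direct_sum n H) (matrix_operator n A)"
proof -
  let ?D = "direct_sum n H"
  \<comment> \<open>The bounds are made nonnegative, by passing to absolute values, so that they can
    be multiplied with inequalities and a row sum is at most the total sum.\<close>
  have "\<exists>C. 0 \<le> C \<and> (\<forall>x\<in>hcarrier H. hnorm H (A i j x) \<le> C * hnorm H x)"
    if ij: "i \<in> {1..n}" "j \<in> {1..n}" for i j
  proof -
    obtain C where C: "\<And>x. x \<in> hcarrier H \<Longrightarrow> hnorm H (A i j x) \<le> C * hnorm H x"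
      using A[OF ij] unfolding bounded_operator_def by blast
    have "hnorm H (A i j x) \<le> \<bar>C\<bar> * hnorm H x" if "x \<in> hcarrier H" for x
      using C[OF that] mult_right_mono[of C "\<bar>C\<bar>" "hnorm H x"] norm_nonneg[OF that] by linarith
    then show ?thesis by (intro exI[of _ "\<bar>C\<bar>"]) auto
  qed
  then obtain C where C0: "\<And>i j. i \<in> {1..n} \<Longrightarrow> j \<in> {1..n} \<Longrightarrow> 0 \<le> C i j"
    and C: "\<And>i j x. i \<in> {1..n} \<Longrightarrow> j \<in> {1..n} \<Longrightarrow> x \<in> hcarrier H \<Longrightarrow>
      hnorm H (A i j x) \<le> C i j * hnorm H x"
    by metis
  have comp: "x k \<in> hcarrier H" if "x \<in> hcarrier ?D" "k \<in> {1..n}" for x k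
    using that by (simp add: direct_sum_def)
  have closed: "A i j (x j) \<in> hcarrier H"
    if "x \<in> hcarrier ?D" "i \<in> {1..n}" "j \<in> {1..n}" for x i j
    using bounded_operator_closed[OF A] comp that by blast
  show ?thesis
  proof (rule bounded_operatorI)
    fix x assume x: "x \<in> hcarrier ?D"
    show "matrix_operator n A x \<in> hcarrier ?D"
      using closed[OF x]
      by (auto simp: direct_sum_def matrix_operator_def intro!: subspace_sum[OF subspace_carrier])
    have le: "hnorm H (x j) \<le> hnorm ?D x" if "j \<in> {1..n}" for j
      using that by (simp add: direct_sum_def)
    have nn: "0 \<le> hnorm ?D x"
      using norm_nonneg[OF comp[OF x, of 1]] le[of 1] n by simp
    show "hnorm ?D (matrix_operator n A x) \<le> (\<Sum>i=1..n. \<Sum>j=1..n. C i j) * hnorm ?D x"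
    proof -
      have "hnorm H (matrix_operator n A x i) \<le> (\<Sum>i=1..n. \<Sum>j=1..n. C i j) * hnorm ?D x"
        if i: "i \<in> {1..n}" for i
      proof -
        have "hnorm H (matrix_operator n A x i) \<le> (\<Sum>j=1..n. hnorm H (A i j (x j)))"
          using i closed[OF x i] norm_sum_le[of "{1..n}" "\<lambda>j. A i j (x j)"]
          by (simp add: matrix_operator_def)
        also have "\<dots> \<le> (\<Sum>j=1..n. C i j * hnorm ?D x)"
        proof (rule sum_mono)
          fix j assume j: "j \<in> {1..n}"
          show "hnorm H (A i j (x j)) \<le> C i j * hnorm ?D x"
            using C[OF i j comp[OF x j]] mult_left_mono[OF le[OF j] C0[OF i j]] by linarith
        qed
        also have "\<dots> = (\<Sum>j=1..n. C i j) * hnorm ?D x"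
          by (simp add: sum_distrib_right)
        also have "\<dots> \<le> (\<Sum>i=1..n. \<Sum>j=1..n. C i j) * hnorm ?D x"
          using i C0 nn by (intro mult_right_mono member_le_sum sum_nonneg) auto
        finally show ?thesis .
      qed
      then show ?thesis
        using n by (subst direct_sum_def) simp
    qed
    show "matrix_operator n A (hscale ?D a x) = hscale ?D a (matrix_operator n A x)" for a
      using bounded_operator_scale[OF A] comp[OF x]
      by (auto simp: direct_sum_def matrix_operator_def fun_eq_iff scale_sum_right)
    fix y assume y: "y \<in> hcarrier ?D"
    show "matrix_operator n A (x + y) = matrix_operator n A x + matrix_operator n A y"
      using bounded_operator_add[OF A] comp[OF x] comp[OF y]
      by (auto simp: matrix_operator_def fun_eq_iff sum.distrib)
  qed
qed

end

section \<open>Bilinearity of the inner product and the calculus of adjoints\<close>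

context padic_hilbert_space
begin

lemma inner_add_left:
  assumes "x \<in> hcarrier H" "y \<in> hcarrier H" "z \<in> hcarrier H"
  shows "hinner H (x + y) z = hinner H x z + hinner H y z"
  using inner_linear[OF assms, of 1] by simp

lemma inner_zero_left: "z \<in> hcarrier H \<Longrightarrow> hinner H 0 z = 0"
  using inner_add_left[of 0 0 z] zero_in_carrier
  by (simp only: add_0_left add_cancel_right_right)

lemma inner_zero_right: "z \<in> hcarrier H \<Longrightarrow> hinner H z 0 = 0"
  using inner_zero_left[of z] inner_commute[OF _ zero_in_carrier] by simp

lemma inner_minus_left:
  assumes "x \<in> hcarrier H" "z \<in> hcarrier H"
  shows "hinner H (- x) z = - hinner H x z"
  using inner_linear[OF assms(1) zero_in_carrier assms(2), of "-1"] inner_zero_left[OF assms(2)]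
  by (simp add: scale_minus_left)

lemma inner_minus_right:
  assumes "x \<in> hcarrier H" "z \<in> hcarrier H"
  shows "hinner H z (- x) = - hinner H z x"
  using inner_minus_left[OF assms] inner_commute assms subspace_neg[OF subspace_carrier] by simp

lemma inner_sum_left:
  assumes "finite A" "\<And>k. k \<in> A \<Longrightarrow> f k \<in> hcarrier H" "z \<in> hcarrier H"
  shows "hinner H (sum f A) z = (\<Sum>k\<in>A. hinner H (f k) z)"
  using assms(1,2)
proof (induction A rule: finite_induct)
  case empty
  then show ?case using assms(3) by (simp add: inner_zero_left)
next
  case (insert a A)
  then show ?case
    using assms(3) subspace_sum[OF subspace_carrier, of A f] by (simp add: inner_add_left)
qed

lemma inner_sum_right:
  assumes "finite A" "\<And>k. k \<in> A \<Longrightarrow> f k \<in> hcarrier H" "z \<in> hcarrier H"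
  shows "hinner H z (sum f A) = (\<Sum>k\<in>A. hinner H z (f k))"
  using inner_sum_left[OF assms] inner_commute[OF assms(3)] assms(2)
    subspace_sum[OF subspace_carrier, of A f] by simp

text \<open>Nondegeneracy is applied to \<open>x - y\<close>; symmetry moves the hypothesis to the
  first argument.\<close>

lemma inner_ext:
  assumes "x \<in> hcarrier H" "y \<in> hcarrier H"
    and eq: "\<And>z. z \<in> hcarrier H \<Longrightarrow> hinner H z x = hinner H z y"
  shows "x = y"
proof -
  have "hinner H (x - y) z = 0" if "z \<in> hcarrier H" for z
    using inner_add_left[of x "- y" z] inner_minus_left[of y z] that assms(1,2) eq[OF that]
      subspace_neg[OF subspace_carrier] by (simp add: inner_commute)
  then show ?thesis
    using inner_nondegenerate[OF carrier_diff[OF assms(1,2)]] by simp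
qed

lemma is_adjoint_sym: "is_adjoint H T S \<Longrightarrow> is_adjoint H S T"
  unfolding is_adjoint_def using bounded_operator_closed inner_commute by metis

lemma is_adjoint_unique:
  assumes "is_adjoint H T S" "is_adjoint H T S'" "x \<in> hcarrier H"
  shows "S x = S' x"
proof (rule inner_ext)
  show "S x \<in> hcarrier H" "S' x \<in> hcarrier H"
    using assms bounded_operator_closed unfolding is_adjoint_def by blast+
  show "hinner H z (S x) = hinner H z (S' x)" if "z \<in> hcarrier H" for z
    using assms that unfolding is_adjoint_def by metis
qed

text \<open>This allows the arbitrary choice made in \<open>adj\<close> to be replaced by any
  explicit adjoint, though only on the carrier.\<close>

lemma is_adjoint_adj_eq:
  assumes "is_adjoint H T S" "x \<in> hcarrier H"
  shows "adj H T x = S x"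
  using is_adjoint_unique adj_is_adjoint assms unfolding adjointable_def by blast

text \<open>Both sides are adjoints of the same operator, \<open>T A = B T\<close>, taken factor by
  factor in reverse order. With \<open>A = M\<close> and \<open>B = M'\<close> it turns $T M_T =
  M_{T^*} T$ into $M_T T^* = T^* M_{T^*}$.\<close>

lemma is_adjoint_intertwine:
  assumes T: "is_adjoint H T S" and A: "is_adjoint H A A'" and B: "is_adjoint H B B'"
    and TA: "\<And>x. x \<in> hcarrier H \<Longrightarrow> T (A x) = B (T x)" and y: "y \<in> hcarrier H"
  shows "A' (S y) = S (B' y)"
proof (rule inner_ext)
  have cl: "T x \<in> hcarrier H" "S x \<in> hcarrier H" "A x \<in> hcarrier H" "A' x \<in> hcarrier H"
    "B' x \<in> hcarrier H" if "x \<in> hcarrier H" for x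
    using T A B that bounded_operator_closed unfolding is_adjoint_def by blast+
  show "A' (S y) \<in> hcarrier H" "S (B' y) \<in> hcarrier H"
    using cl y by blast+
  fix z assume z: "z \<in> hcarrier H"
  have "hinner H z (A' (S y)) = hinner H (T (A z)) y"
    using T A z y cl unfolding is_adjoint_def by simp
  also have "\<dots> = hinner H z (S (B' y))"
    using T B z y cl TA unfolding is_adjoint_def by simp
  finally show "hinner H z (A' (S y)) = hinner H z (S (B' y))" .
qed

lemma is_adjoint_zero: "is_adjoint H (\<lambda>x. 0) (\<lambda>x. 0)"
  by (simp add: is_adjoint_def bounded_operator_zero inner_zero_left inner_zero_right)

lemma is_adjoint_id: "is_adjoint H (\<lambda>x. x) (\<lambda>x. x)"
  by (simp add: is_adjoint_def bounded_operator_id)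

lemma is_adjoint_minus:
  assumes "is_adjoint H T S"
  shows "is_adjoint H (\<lambda>x. - T x) (\<lambda>x. - S x)"
  using assms unfolding is_adjoint_def
  by (auto simp: bounded_operator_minus inner_minus_left inner_minus_right
      bounded_operator_closed[of H T] bounded_operator_closed[of H S])

text \<open>Expanding both inner products gives the same double sum, up to the order of
  summation.\<close>

lemma is_adjoint_matrix:
  assumes AB: "\<And>i j. i \<in> {1..n} \<Longrightarrow> j \<in> {1..n} \<Longrightarrow> is_adjoint H (A i j) (B j i)" and n: "1 \<le> n"
  shows "is_adjoint (direct_sum n H) (matrix_operator n A) (matrix_operator n B)"
proof -
  have A: "bounded_operator H (A i j)" and B: "bounded_operator H (B j i)"
    and adj: "\<And>x y. x \<in> hcarrier H \<Longrightarrow> y \<in> hcarrier H \<Longrightarrow>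
      hinner H (A i j x) y = hinner H x (B j i y)"
    if "i \<in> {1..n}" "j \<in> {1..n}" for i j
    using AB[OF that] unfolding is_adjoint_def by auto
  have "hinner (direct_sum n H) (matrix_operator n A x) y =
      hinner (direct_sum n H) x (matrix_operator n B y)"
    if "x \<in> hcarrier (direct_sum n H)" "y \<in> hcarrier (direct_sum n H)" for x y
  proof -
    have x: "x k \<in> hcarrier H" and y: "y k \<in> hcarrier H" if "k \<in> {1..n}" for k
      using \<open>x \<in> _\<close> \<open>y \<in> _\<close> that by (simp_all add: direct_sum_def)
    have "hinner (direct_sum n H) (matrix_operator n A x) y =
        (\<Sum>i=1..n. \<Sum>j=1..n. hinner H (A i j (x j)) (y i))"
      unfolding direct_sum_def matrix_operator_def inner_space.simps
      using x y bounded_operator_closed[OF A]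
      by (intro sum.cong refl) (auto intro!: inner_sum_left)
    also have "\<dots> = (\<Sum>i=1..n. \<Sum>j=1..n. hinner H (x j) (B j i (y i)))"
      using x y by (intro sum.cong refl adj) auto
    also have "\<dots> = (\<Sum>j=1..n. \<Sum>i=1..n. hinner H (x j) (B j i (y i)))"
      by (rule sum.swap)
    also have "\<dots> = hinner (direct_sum n H) x (matrix_operator n B y)"
      unfolding direct_sum_def matrix_operator_def inner_space.simps
      using x y bounded_operator_closed[OF B]
      by (intro sum.cong refl) (auto intro!: inner_sum_right[symmetric])
    finally show ?thesis .
  qed
  then show ?thesis
    unfolding is_adjoint_def using A B n by (blast intro: bounded_operator_matrix)
qed

end

section \<open>The adjoint of the dilation and unitarity\<close>

text \<open>
  The conditions put \<open>j\<close> before \<open>i\<close> so that they coincide literally with those of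
  \<open>dilation_matrix\<close> once the indices are exchanged.
\<close>

definition dilation_adjoint_matrix ::
    "('k, 'a::ab_group_add) inner_space \<Rightarrow> nat \<Rightarrow> ('a \<Rightarrow> 'a) \<Rightarrow> ('a \<Rightarrow> 'a) \<Rightarrow> ('a \<Rightarrow> 'a)
       \<Rightarrow> nat \<Rightarrow> nat \<Rightarrow> 'a \<Rightarrow> 'a" where
  "dilation_adjoint_matrix H N T M M' i j =
     (if j = 1 \<and> i = 1 then adj H T
      else if j = 1 \<and> i = N + 1 then M'
      else if j = 2 \<and> i = 1 then M
      else if j = 2 \<and> i = N + 1 then (\<lambda>x. - T x)
      else if 3 \<le> j \<and> i + 1 = j then (\<lambda>x. x)
      else (\<lambda>x. 0))"

definition dilation_adjoint ::
    "('k, 'a::ab_group_add) inner_space \<Rightarrow> nat \<Rightarrow> ('a \<Rightarrow> 'a) \<Rightarrow> ('a \<Rightarrow> 'a) \<Rightarrow> ('a \<Rightarrow> 'a)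
       \<Rightarrow> (nat \<Rightarrow> 'a) \<Rightarrow> nat \<Rightarrow> 'a" where
  "dilation_adjoint H N T M M' = matrix_operator (N + 1) (dilation_adjoint_matrix H N T M M')"

lemma dilation_adjoint_apply:
  assumes "1 \<le> N"
  shows "dilation_adjoint H N T M M' y =
    (\<lambda>i. if i = 1 then adj H T (y 1) + M (y 2)
         else if 2 \<le> i \<and> i \<le> N then y (i + 1)
         else if i = N + 1 then M' (y 1) - T (y 2)
         else 0)"
proof
  fix i
  \<comment> \<open>Rows \<open>1\<close> and \<open>N + 1\<close> live in columns \<open>1\<close>
    and \<open>2\<close>: the guard \<open>3 \<le> j\<close> keeps the identity out of row
    \<open>1\<close>, and in row \<open>N + 1\<close> it would need column
    \<open>N + 2\<close>.\<close>
  have two: "(\<Sum>j=1..N+1. f j) = f 1 + f 2" if "\<And>j. 3 \<le> j \<Longrightarrow> j \<le> N + 1 \<Longrightarrow> f j = 0"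
    for f :: "nat \<Rightarrow> 'a"
  proof -
    have "(\<Sum>j=1..N+1. f j) = (\<Sum>j\<in>{1, 2}. f j)"
      using assms that by (intro sum.mono_neutral_right) auto
    then show ?thesis by simp
  qed
  have one: "(\<Sum>j=1..N+1. if i + 1 = j then y j else 0) = y (i + 1)" if "2 \<le> i" "i \<le> N"
    using that by simp
  consider "i = 1" | "2 \<le> i" "i \<le> N" | "i = N + 1" | "i = 0 \<or> N + 1 < i" by linarith
  then show "dilation_adjoint H N T M M' y i =
    (if i = 1 then adj H T (y 1) + M (y 2)
         else if 2 \<le> i \<and> i \<le> N then y (i + 1)
         else if i = N + 1 then M' (y 1) - T (y 2)
         else 0)"
  proof cases
    case 1
    then show ?thesis using assms unfolding dilation_adjoint_def matrix_operator_def
      by (subst two) (auto simp: dilation_adjoint_matrix_def)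
  next
    case 2
    \<comment> \<open>Here \<open>i + 1 = j\<close> already forces \<open>3 \<le> j\<close>, and the
      rows of the other four entries are excluded, so only the shift remains.\<close>
    have "dilation_adjoint_matrix H N T M M' i j (y j) = (if i + 1 = j then y j else 0)" for j
      using 2 by (auto simp: dilation_adjoint_matrix_def)
    then have "dilation_adjoint H N T M M' y i = (\<Sum>j=1..N+1. if i + 1 = j then y j else 0)"
      using 2 by (simp add: dilation_adjoint_def matrix_operator_def)
    then show ?thesis using 2 one by auto
  next
    case 3
    then show ?thesis using assms unfolding dilation_adjoint_def matrix_operator_def
      by (subst two) (auto simp: dilation_adjoint_matrix_def)
  next
    case 4
    then show ?thesis using assms by (auto simp: dilation_adjoint_def matrix_operator_def)
  qed
qed

lemma (in padic_hilbert_space) is_adjoint_dilation: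
  assumes T: "adjointable H T" and M: "self_adjoint H M" and M': "self_adjoint H M'"
  shows "is_adjoint (direct_sum (N + 1) H) (dilation H N T M M') (dilation_adjoint H N T M M')"
  unfolding dilation_def dilation_adjoint_def
proof (rule is_adjoint_matrix)
  fix i j :: nat
  note TS = adj_is_adjoint[OF T]
  \<comment> \<open>Both matrices branch on the same conditions once the indices are exchanged, so
    adjointness can be checked branch by branch.\<close>
  have if_adjoint: "is_adjoint H (if P then A else B) (if P then A' else B')"
    if "is_adjoint H A A'" "is_adjoint H B B'" for P A A' B B'
    using that by simp
  show "is_adjoint H (dilation_matrix H N T M M' i j) (dilation_adjoint_matrix H N T M M' j i)"
    unfolding dilation_matrix_def dilation_adjoint_matrix_def
    by (intro if_adjoint TS is_adjoint_minus[OF is_adjoint_sym[OF TS]] is_adjoint_id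
        is_adjoint_zero self_adjoint_is_adjoint[OF M] self_adjoint_is_adjoint[OF M'])
qed simp

text \<open>The two shifts cancel in the remaining coordinates. In coordinates \<open>1\<close> and
  \<open>2\<close> of $U U^*$, and \<open>1\<close> and \<open>N + 1\<close> of $U^* U$, the
  diagonal terms add up by the formulas for the squares of \<open>M\<close> and \<open>M'\<close>,
  and the mixed terms cancel by the intertwining relations.\<close>

lemma (in padic_hilbert_space) dilation_adjoint_inverse:
  assumes T: "adjointable H T" and MM': "magic_operators H T M M'"
    and N: "1 \<le> N" and x: "x \<in> hcarrier (direct_sum (N + 1) H)"
  shows "dilation H N T M M' (dilation_adjoint H N T M M' x) = x"
    and "dilation_adjoint H N T M M' (dilation H N T M M' x) = x"
proof -
  note TS = adj_is_adjoint[OF T]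
  have M: "is_adjoint H M M" and M': "is_adjoint H M' M'"
    using MM' self_adjoint_is_adjoint unfolding magic_operators_def by auto
  have bd: "bounded_operator H T" "bounded_operator H (adj H T)" "bounded_operator H M"
    "bounded_operator H M'"
    using TS M M' unfolding is_adjoint_def by auto
  have cl: "T z \<in> hcarrier H" "adj H T z \<in> hcarrier H" "M z \<in> hcarrier H" "M' z \<in> hcarrier H"
    if "z \<in> hcarrier H" for z
    using bd bounded_operator_closed that by blast+
  have rel: "M (M z) = z - adj H T (T z)" "M' (M' z) = z - T (adj H T z)" "T (M z) = M' (T z)"
    if "z \<in> hcarrier H" for z
    using MM' that unfolding magic_operators_def by auto
  have rel': "M (adj H T z) = adj H T (M' z)" if "z \<in> hcarrier H" for z
    using is_adjoint_intertwine[OF TS M M' rel(3) that] by simp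
  note hom = bd[THEN bounded_operator_add] bd[THEN bounded_operator_diff]
  have xk: "x k \<in> hcarrier H" for k
    using x zero_in_carrier by (cases "k \<in> {1..N+1}") (auto simp: direct_sum_def)
  have x0: "x k = 0" if "k = 0 \<or> N + 1 < k" for k
    using x that by (auto simp: direct_sum_def)
  show "dilation H N T M M' (dilation_adjoint H N T M M' x) = x"
  proof
    fix i
    consider "i = 1" | "i = 2" | "3 \<le> i" "i \<le> N + 1" | "i = 0 \<or> N + 1 < i" by linarith
    then show "dilation H N T M M' (dilation_adjoint H N T M M' x) i = x i"
      using N by cases (auto simp: dilation_apply dilation_adjoint_apply xk x0 hom cl rel rel')
  qed
  show "dilation_adjoint H N T M M' (dilation H N T M M' x) = x"
  proof
    fix i
    consider "i = 1" | "2 \<le> i" "i \<le> N" | "i = N + 1" | "i = 0 \<or> N + 1 < i" by linarith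
    then show "dilation_adjoint H N T M M' (dilation H N T M M' x) i = x i"
      using N by cases (auto simp: dilation_apply dilation_adjoint_apply xk x0 hom cl rel rel')
  qed
qed

section \<open>Powers of the dilation and of its adjoint\<close>

text \<open>The vanishing part is the invariant that drives the induction: each step extends the
  support by at most one place, so before the step from \<open>k < N\<close> coordinate
  \<open>N + 1\<close> is still zero and \<open>M'\<close> contributes nothing to the first
  coordinate.\<close>

lemma dilation_power:
  assumes "M' 0 = 0" "1 \<le> N" "k \<le> N"
  shows "(dilation H N T M M' ^^ k) (first_embedding x) 1 = (T ^^ k) x \<and>
    (\<forall>j>k + 1. (dilation H N T M M' ^^ k) (first_embedding x) j = 0)"
  using assms(3)
proof (induction k)
  case 0
  then show ?case by (simp add: first_embedding_def)
next
  case (Suc k)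
  then show ?case using assms(1,2) by (auto simp: dilation_apply)
qed

text \<open>New entries now enter at coordinate \<open>N + 1\<close> and move down by one place per
  step. After \<open>k < N\<close> steps coordinate \<open>2\<close>, the only other one feeding the
  first, is still zero, so only \<open>adj H T\<close> acts there.\<close>

lemma dilation_adjoint_power:
  assumes "M 0 = 0" "1 \<le> N" "k \<le> N"
  shows "(dilation_adjoint H N T M M' ^^ k) (first_embedding x) 1 = (adj H T ^^ k) x \<and>
    (\<forall>j. 2 \<le> j \<and> j + k \<le> N + 1 \<longrightarrow>
      (dilation_adjoint H N T M M' ^^ k) (first_embedding x) j = 0)"
  using assms(3)
proof (induction k)
  case 0
  then show ?case by (simp add: first_embedding_def)
next
  case (Suc k)
  then show ?case using assms(1,2) by (auto simp: dilation_adjoint_apply)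
qed

theorem theorem2p7:
  fixes v :: "'k::field \<Rightarrow> real"
    and H :: "('k, 'a::ab_group_add) inner_space"
    and T M M' :: "'a \<Rightarrow> 'a"
    and N :: nat
  assumes "padic_hilbert_space v H"
    and "magic_contraction H T"
    and "magic_operators H T M M'"
    and "1 \<le> N"
  shows "unitary (direct_sum (N + 1) H) (dilation H N T M M') \<and>
    (\<forall>k\<in>{1..N}. \<forall>x\<in>hcarrier H.
       (T ^^ k) x =
         first_projection ((dilation H N T M M' ^^ k) (first_embedding x)) \<and>
       (adj H T ^^ k) x =
         first_projection
           ((adj (direct_sum (N + 1) H) (dilation H N T M M') ^^ k) (first_embedding x)))"
proof -
  interpret padic_hilbert_space v H by fact
  let ?D = "direct_sum (N + 1) H"
  let ?U = "dilation H N T M M'"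
  let ?V = "dilation_adjoint H N T M M'"
  interpret D: padic_hilbert_space v ?D
    by (rule padic_hilbert_space_direct_sum) simp
  have T: "adjointable H T"
    using assms(2) unfolding magic_contraction_def by blast
  have M: "self_adjoint H M" "self_adjoint H M'"
    using assms(3) unfolding magic_operators_def by auto
  have UV: "is_adjoint ?D ?U ?V"
    using is_adjoint_dilation[OF T M] .
  have adj_eq: "adj ?D ?U y = ?V y" if "y \<in> hcarrier ?D" for y
    using D.is_adjoint_adj_eq[OF UV that] .
  have U_in: "?U y \<in> hcarrier ?D" and V_in: "?V y \<in> hcarrier ?D" if "y \<in> hcarrier ?D" for y
    using UV that bounded_operator_closed unfolding is_adjoint_def by blast+
  have "unitary ?D ?U"
    unfolding unitary_def
  proof (intro conjI ballI)
    show "adjointable ?D ?U"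
      unfolding adjointable_def using UV by blast
    show "?U (adj ?D ?U y) = y" if "y \<in> hcarrier ?D" for y
      unfolding adj_eq[OF that] by (rule dilation_adjoint_inverse(1)[OF T assms(3,4) that])
    show "adj ?D ?U (?U y) = y" if "y \<in> hcarrier ?D" for y
      unfolding adj_eq[OF U_in[OF that]]
      by (rule dilation_adjoint_inverse(2)[OF T assms(3,4) that])
  qed
  moreover have "M 0 = 0" "M' 0 = 0"
    using M[THEN self_adjoint_is_adjoint] bounded_operator_0
    unfolding is_adjoint_def by auto
  moreover have "(adj ?D ?U ^^ k) (first_embedding x) = (?V ^^ k) (first_embedding x)"
    if x: "x \<in> hcarrier H" for k x
  proof -
    have e: "first_embedding x \<in> hcarrier ?D"
      using x zero_in_carrier by (auto simp: direct_sum_def first_embedding_def)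
    \<comment> \<open>The chosen adjoint and \<open>?V\<close> agree on the carrier only, so
      replacing one by the other in a power requires every iterate to stay in the carrier.\<close>
    have V_power: "(?V ^^ k) (first_embedding x) \<in> hcarrier ?D" for k
      by (induction k) (use e V_in in auto)
    show ?thesis
      by (induction k) (simp_all only: funpow.simps comp_apply adj_eq[OF V_power])
  qed
  ultimately show ?thesis
    using dilation_power[of M' N _ H T M] dilation_adjoint_power[of M N _ H T M'] assms(4)
    unfolding first_projection_def by (metis atLeastAtMost_iff)
qed

end
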